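(* For every integer $N \ge 7$, $$Q(N,3, \le) = N+1- \left \lfloor \frac{N+1}{4} \right \rfloor.$$
   Context: There are $N$ balls $b_1,\dots,b_N$, each colored red or green, with strictly fewer green than red balls (a Red-green coloring). For an integer $0\le p<\frac N2$, the coloring is $p$-majored if at most $p$ balls are green. A comparison consists of choosing two balls and being told whether or not they have the same color (only "same" or "different" is answered). A method is an adaptive deterministic strategy: each comparison may depend on the answers to the previous ones. $Q(N,p,\le)$ is the minimum integer $k$ such that there exists a method which, for every $p$-majored Red-green coloring of the $N$ balls (it being known in advance that the coloring is $p$-majored), determines for sure the color of every ball after at most $k$ comparisons. *)

theory Defs
  imports Main
begin

datatype color = Red | Green

definition balls :: "nat \<Rightarrow> nat set" where
  "balls N = {1..N}"

(* A coloring is a function on all naturals; only its values on balls N matter. *)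

definition red_green :: "nat \<Rightarrow> (nat \<Rightarrow> color) \<Rightarrow> bool" where
  "red_green N c \<longleftrightarrow>
     card {i \<in> balls N. c i = Green} < card {i \<in> balls N. c i = Red}"

definition majored :: "nat \<Rightarrow> nat \<Rightarrow> (nat \<Rightarrow> color) \<Rightarrow> bool" where
  "majored N p c \<longleftrightarrow>
     red_green N c \<and> card {i \<in> balls N. c i = Green} \<le> p"

(* Adaptive deterministic strategies as decision trees: Compare i j s d compares the
   balls i and j and continues with s on the answer "same" and with d on the answer
   "different"; Announce v stops and declares the color of every ball.  As the
   declaration is a function of the answers only, a correct declaration for every
   admissible coloring means exactly that the answers determine the coloring. *)

datatype strategy =
    Announce "nat \<Rightarrow> color"
  | Compare nat nat strategy strategy

fun legal :: "nat \<Rightarrow> strategy \<Rightarrow> bool" where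
  "legal N (Announce v) \<longleftrightarrow> True"
| "legal N (Compare i j s d) \<longleftrightarrow>
     i \<in> balls N \<and> j \<in> balls N \<and> i \<noteq> j \<and> legal N s \<and> legal N d"

fun announced :: "strategy \<Rightarrow> (nat \<Rightarrow> color) \<Rightarrow> nat \<Rightarrow> color" where
  "announced (Announce v) c = v"
| "announced (Compare i j s d) c = (if c i = c j then announced s c else announced d c)"

fun comparisons :: "strategy \<Rightarrow> (nat \<Rightarrow> color) \<Rightarrow> nat" where
  "comparisons (Announce v) c = 0"
| "comparisons (Compare i j s d) c =
     Suc (if c i = c j then comparisons s c else comparisons d c)"

definition solves :: "nat \<Rightarrow> nat \<Rightarrow> nat \<Rightarrow> strategy \<Rightarrow> bool" where
  "solves N p k t \<longleftrightarrow> legal N t \<and>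
     (\<forall>c. majored N p c \<longrightarrow>
        (\<forall>i\<in>balls N. announced t c i = c i) \<and> comparisons t c \<le> k)"

(* Q_le N p is Q(N, p, \<le>), intended for 2 * p < N.  The set of admissible k is nonempty:
   N - 1 comparisons with a fixed ball split the balls into the two color classes, and
   the red class is the larger one. *)

definition Q_le :: "nat \<Rightarrow> nat \<Rightarrow> nat" where
  "Q_le N p = (LEAST k. \<exists>t. solves N p k t)"

end

theory Submission
  imports Defs "HOL-Library.Multiset"
begin

text \<open>
  The comparisons made so far split the balls into connected components, and within a component the
  coloring is known up to exchanging the two colors. Only the difference between the sizes of its two
  classes, its weight, matters, together with the number \<open>r\<close> of further green balls that are allowed
  once the smaller class of every component is taken to be green. A component is determined
  exactly if its weight exceeds \<open>r\<close>. Comparing two components of weights \<open>y \<le> x\<close> leads to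
  a component of weight \<open>x + y\<close>, or to one of weight \<open>x - y\<close> with \<open>r\<close> lowered by \<open>y\<close>. Thus
  identifying colors is a game on multisets of weights, as \<open>solves_iff_resolvable\<close> makes precise.
  A useful comparison merges two components, so the number of comparisons is \<open>N\<close> minus the number of
  components at the end, and the question is how many determined components can be kept apart.

  The questioner builds components one at a time by adding single balls until they are determined
  (\<open>resolvable_accumulate\<close>). If the adversary always chooses sums, each component uses 4 balls.
  A difference wastes two balls but lowers \<open>r\<close>, which makes the later components cheaper. With \<open>4 * m + 3\<close> balls, \<open>m\<close> components are guaranteed.

  The adversary answers with sums, so that each determined component has at least 4 balls, until the
  open weights have total at most 6. If they can then be split into two parts of weight at most 3,
  the adversary sticks to this splitting and nothing more can be determined
  (\<open>resolvable_balanced_part\<close>); at least 3 balls are lost by then. The only obstacle is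
  a position of three twos. It comes from positions consisting of an odd number of twos, and the
  adversary avoids reaching these without loss by a single early difference
  (\<open>resolvable_3_bound\<close>). So \<open>m\<close> components require \<open>4 * m + 3\<close> balls.
\<close>

section \<open>The weight game\<close>

text \<open>A position has a budget \<open>r\<close> of green balls not yet certain and a multiset of
  component weights. A component of weight greater than \<open>r\<close> is determined. A move merges two
  components of weights \<open>y \<le> x\<close>; the adversary chooses between the sum, and the difference at
  the cost of \<open>y\<close> from the budget.\<close>

inductive resolvable :: "nat \<Rightarrow> nat multiset \<Rightarrow> nat \<Rightarrow> bool" where
  settled: "(\<And>x. x \<in># M \<Longrightarrow> r < x) \<Longrightarrow> resolvable r M k"
| merge: "y \<le> x \<Longrightarrow> resolvable r (add_mset (x + y) M) k \<Longrightarrow>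
    (y \<le> r \<Longrightarrow> resolvable (r - y) (add_mset (x - y) M) k) \<Longrightarrow>
    resolvable r (add_mset x (add_mset y M)) (Suc k)"

lemma resolvable_Suc: "resolvable r M k \<Longrightarrow> resolvable r M (Suc k)"
  by (induction rule: resolvable.induct) (auto intro: resolvable.intros)

section \<open>Strategies as plays of the weight game\<close>

text \<open>A component is represented by its two color classes. They are multisets of balls because
  disjointness of all classes is then the single equation defining \<open>partitions\<close>, which survives
  merging by commutativity of addition.\<close>

definition members :: "nat multiset \<times> nat multiset \<Rightarrow> nat multiset" where
  "members X = fst X + snd X"

definition weight :: "nat multiset \<times> nat multiset \<Rightarrow> nat" where
  "weight X = size (fst X) - size (snd X)"

definition consistent :: "(nat \<Rightarrow> color) \<Rightarrow> nat multiset \<times> nat multiset \<Rightarrow> bool" where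
  "consistent c X \<longleftrightarrow> (\<exists>a. (\<forall>i\<in>#fst X. c i = a) \<and> (\<forall>i\<in>#snd X. c i \<noteq> a))"

definition partitions :: "nat \<Rightarrow> (nat multiset \<times> nat multiset) multiset \<Rightarrow> bool" where
  "partitions N C \<longleftrightarrow> (\<Sum>X\<in>#C. members X) = mset_set (balls N)"

text \<open>The first class of a component is the larger one, so it is the red class unless the component
  spends some of the budget of green balls. Being nonempty, it also provides a ball through which
  the component can be compared.\<close>

definition oriented :: "(nat multiset \<times> nat multiset) multiset \<Rightarrow> bool" where
  "oriented C \<longleftrightarrow> (\<forall>X\<in>#C. size (snd X) \<le> size (fst X) \<and> fst X \<noteq> {#})"

text \<open>Exactly one class of every component is green and the second one is the smaller, hence at
  least this many balls are green.\<close>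

definition forced :: "(nat multiset \<times> nat multiset) multiset \<Rightarrow> nat" where
  "forced C = (\<Sum>X\<in>#C. size (snd X))"

definition greens :: "nat \<Rightarrow> (nat \<Rightarrow> color) \<Rightarrow> nat" where
  "greens N c = card {i \<in> balls N. c i = Green}"

definition possible ::
    "nat \<Rightarrow> nat \<Rightarrow> (nat multiset \<times> nat multiset) multiset \<Rightarrow> (nat \<Rightarrow> color) set" where
  "possible N p C = {c. greens N c \<le> p \<and> (\<forall>X\<in>#C. consistent c X)}"

definition identifies :: "nat \<Rightarrow> (nat \<Rightarrow> color) set \<Rightarrow> strategy \<Rightarrow> nat \<Rightarrow> bool" where
  "identifies N T t k \<longleftrightarrow> legal N t \<and>
     (\<forall>c\<in>T. (\<forall>i\<in>balls N. announced t c i = c i) \<and> comparisons t c \<le> k)"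

text \<open>The two ways in which a comparison can join two components: first class with first class, or
  crosswise.\<close>

definition aligned where "aligned X Y = (fst X + fst Y, snd X + snd Y)"

definition opposed where "opposed X Y = (fst X + snd Y, snd X + fst Y)"

lemma finite_balls [simp]: "finite (balls N)"
  by (simp add: balls_def)

lemma filter_mset_sum_mset:
  "filter_mset P (\<Sum>X\<in>#C. f X) = (\<Sum>X\<in>#C. filter_mset P (f X))"
  by (induction C) auto

lemma sum_members: "(\<Sum>X\<in>#C. members X) = (\<Sum>X\<in>#C. fst X) + (\<Sum>X\<in>#C. snd X)"
  by (induction C) (auto simp: members_def)

lemma size_sum_mset: "size (\<Sum>X\<in>#C. f X :: nat multiset) = (\<Sum>X\<in>#C. size (f X))"
  by (induction C) auto

lemma greens_eq_sum:
  assumes "partitions N C"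
  shows "greens N c = (\<Sum>X\<in>#C. size (filter_mset (\<lambda>i. c i = Green) (members X)))"
proof -
  have "greens N c = size (filter_mset (\<lambda>i. c i = Green) (mset_set (balls N)))"
    by (simp add: greens_def filter_mset_mset_set)
  then show ?thesis
    using assms unfolding partitions_def by (metis filter_mset_sum_mset size_sum_mset)
qed

lemma consistent_cases:
  assumes "consistent c X"
  obtains (fst_green) "\<forall>i\<in>#fst X. c i = Green" "\<forall>i\<in>#snd X. c i = Red"
      "size (filter_mset (\<lambda>i. c i = Green) (members X)) = size (fst X)"
  | (snd_green) "\<forall>i\<in>#fst X. c i = Red" "\<forall>i\<in>#snd X. c i = Green"
      "size (filter_mset (\<lambda>i. c i = Green) (members X)) = size (snd X)"
proof -
  obtain a where a: "\<forall>i\<in>#fst X. c i = a" "\<forall>i\<in>#snd X. c i \<noteq> a"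
    using assms by (auto simp: consistent_def)
  show thesis
  proof (cases a)
    case Green
    then have "\<forall>i\<in>#snd X. c i = Red" using a by (metis color.exhaust)
    moreover from this have "filter_mset (\<lambda>i. c i = Green) (members X) = fst X"
      using a Green unfolding members_def filter_mset_eq_conv by auto
    ultimately show thesis using fst_green a Green by simp
  next
    case Red
    then have "\<forall>i\<in>#snd X. c i = Green" using a by (metis color.exhaust)
    moreover from this have "filter_mset (\<lambda>i. c i = Green) (members X) = snd X"
      using a Red unfolding members_def filter_mset_eq_conv by auto
    ultimately show thesis using snd_green a Red by simp
  qed
qed

lemma forced_le_greens:
  assumes "partitions N C" "oriented C" "\<forall>X\<in>#C. consistent c X"
  shows "forced C \<le> greens N c"
  unfolding greens_eq_sum[OF assms(1)] forced_def
proof (rule sum_mset_mono)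
  fix X assume X: "X \<in># C"
  then have "consistent c X" using assms by blast
  then show "size (snd X) \<le> size (filter_mset (\<lambda>i. c i = Green) (members X))"
    using assms(2) X by (cases rule: consistent_cases) (auto simp: oriented_def)
qed

text \<open>If the larger class of \<open>X\<close> were green, it would add \<open>weight X\<close> to the certain green balls and
  exceed the budget.\<close>

lemma heavy_component_determined:
  assumes "partitions N C" "oriented C" "c \<in> possible N p C" "X \<in># C" "p < forced C + weight X"
  shows "(\<forall>i\<in>#fst X. c i = Red) \<and> (\<forall>i\<in>#snd X. c i = Green)"
proof -
  obtain C' where C: "C = add_mset X C'" using assms(4) by (meson multi_member_split)
  have "consistent c X" using assms by (auto simp: possible_def)
  then show ?thesis
  proof (cases rule: consistent_cases)
    case fst_green
    have "forced C' \<le> (\<Sum>X\<in>#C'. size (filter_mset (\<lambda>i. c i = Green) (members X)))"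
      unfolding forced_def
    proof (rule sum_mset_mono)
      fix X assume X: "X \<in># C'"
      then have "consistent c X" using assms C by (auto simp: possible_def)
      then show "size (snd X) \<le> size (filter_mset (\<lambda>i. c i = Green) (members X))"
        using assms(2) X C by (cases rule: consistent_cases) (auto simp: oriented_def)
    qed
    then have "forced C + weight X \<le> greens N c"
      using greens_eq_sum[OF assms(1), of c] fst_green(3) assms(2)
      by (simp add: C forced_def weight_def oriented_def)
    then show ?thesis using assms by (simp add: possible_def)
  qed auto
qed

lemma card_set_mset_le_size: "card (set_mset M) \<le> size M"
  by (induction M) (auto simp: card_insert_if)

lemma fst_not_in_minority:
  assumes "partitions N C" "X \<in># C" "i \<in># fst X"
  shows "i \<notin># (\<Sum>X\<in>#C. snd X)"
proof -
  have "count (\<Sum>X\<in>#C. fst X) i + count (\<Sum>X\<in>#C. snd X) i \<le> 1"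
    using assms(1) by (simp add: partitions_def sum_members count_mset_set' flip: count_union)
  moreover have "0 < count (\<Sum>X\<in>#C. fst X) i" using assms(2,3) by auto
  ultimately have "count (\<Sum>X\<in>#C. snd X) i = 0" by linarith
  then show ?thesis by (simp only: not_in_iff)
qed

text \<open>The cheapest coloring: every component has its second class green. Turning over one component
  and taking the cheapest coloring again shows that a component of weight within the remaining
  budget is still open.\<close>

definition minority_coloring :: "(nat multiset \<times> nat multiset) multiset \<Rightarrow> nat \<Rightarrow> color" where
  "minority_coloring C i = (if i \<in># (\<Sum>X\<in>#C. snd X) then Green else Red)"

lemma minority_coloring_possible:
  assumes "partitions N C" "forced C \<le> p"
  shows "minority_coloring C \<in> possible N p C" (is "?c \<in> _")
proof -
  have "greens N ?c \<le> card (set_mset (\<Sum>X\<in>#C. snd X))"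
    unfolding greens_def
    by (intro card_mono) (auto simp: minority_coloring_def split: if_splits)
  also have "\<dots> \<le> forced C"
    unfolding forced_def size_sum_mset[symmetric] by (rule card_set_mset_le_size)
  finally have "greens N ?c \<le> p" using assms by simp
  moreover have "consistent ?c X" if X: "X \<in># C" for X
    unfolding consistent_def
  proof (intro exI[of _ Red] conjI ballI)
    fix i assume i: "i \<in># fst X"
    show "?c i = Red" using fst_not_in_minority[OF assms(1) X i]
      by (simp add: minority_coloring_def)
  next
    fix i assume "i \<in># snd X"
    then show "?c i \<noteq> Red" using X by (auto simp: minority_coloring_def)
  qed
  ultimately show ?thesis by (simp add: possible_def)
qed

lemma weight_aligned_opposed:
  assumes "oriented (add_mset X (add_mset Y C))" "weight Y \<le> weight X"
  shows "weight (aligned X Y) = weight X + weight Y" "weight (opposed X Y) = weight X - weight Y"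
    "oriented (add_mset (aligned X Y) C)" "oriented (add_mset (opposed X Y) C)"
    "forced (add_mset (aligned X Y) C) = forced (add_mset X (add_mset Y C))"
    "forced (add_mset (opposed X Y) C) = forced (add_mset X (add_mset Y C)) + weight Y"
  using assms by (auto simp: weight_def aligned_def opposed_def oriented_def forced_def)

lemma partitions_aligned_opposed:
  "partitions N (add_mset (aligned X Y) C) = partitions N (add_mset X (add_mset Y C))"
  "partitions N (add_mset (opposed X Y) C) = partitions N (add_mset X (add_mset Y C))"
  by (simp_all add: partitions_def members_def aligned_def opposed_def ac_simps)

text \<open>Knowing both components and the answer to one comparison between them is the same as knowing
  the merged component. For balls from the second classes this relies on there being only two
  colors: both balls avoid the color of their first classes.\<close>

lemma consistent_aligned:
  assumes "i \<in># fst X \<and> j \<in># fst Y \<or> i \<in># snd X \<and> j \<in># snd Y"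
  shows "consistent c X \<and> consistent c Y \<and> c i = c j \<longleftrightarrow> consistent c (aligned X Y)"
proof
  assume *: "consistent c X \<and> consistent c Y \<and> c i = c j"
  then obtain a b where a: "\<forall>i\<in>#fst X. c i = a" "\<forall>i\<in>#snd X. c i \<noteq> a"
    and b: "\<forall>i\<in>#fst Y. c i = b" "\<forall>i\<in>#snd Y. c i \<noteq> b"
    by (auto simp: consistent_def)
  have "a = b" using assms * a b by (metis color.exhaust)
  then show "consistent c (aligned X Y)" using a b by (auto simp: consistent_def aligned_def)
next
  assume "consistent c (aligned X Y)"
  then obtain a where a: "\<forall>i\<in>#fst X + fst Y. c i = a" "\<forall>i\<in>#snd X + snd Y. c i \<noteq> a"
    by (auto simp: consistent_def aligned_def)
  have "c i = c j" using assms
  proof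
    assume "i \<in># fst X \<and> j \<in># fst Y"
    then show ?thesis using a(1) by simp
  next
    assume "i \<in># snd X \<and> j \<in># snd Y"
    then have "c i \<noteq> a" "c j \<noteq> a" using a(2) by simp_all
    then show ?thesis by (metis color.exhaust)
  qed
  then show "consistent c X \<and> consistent c Y \<and> c i = c j"
    using a unfolding consistent_def by auto
qed

lemma consistent_swap: "consistent c (snd X, fst X) = consistent c X"
proof -
  have "consistent c (snd X, fst X)" if X: "consistent c X" for X
    using X
  proof (cases rule: consistent_cases)
    case fst_green
    then show ?thesis unfolding consistent_def by (intro exI[of _ Red]) auto
  next
    case snd_green
    then show ?thesis unfolding consistent_def by (intro exI[of _ Green]) auto
  qed
  from this[of X] this[of "(snd X, fst X)"] show ?thesis by auto
qed

lemma consistent_imp_aligned_or_opposed: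
  assumes "consistent c X" "consistent c Y"
  shows "consistent c (aligned X Y) \<or> consistent c (opposed X Y)"
proof -
  obtain a b where a: "\<forall>i\<in>#fst X. c i = a" "\<forall>i\<in>#snd X. c i \<noteq> a"
    and b: "\<forall>i\<in>#fst Y. c i = b" "\<forall>i\<in>#snd Y. c i \<noteq> b"
    using assms by (auto simp: consistent_def)
  show ?thesis
  proof (cases "a = b")
    case True
    then show ?thesis using a b by (auto simp: consistent_def aligned_def)
  next
    case False
    then have "\<forall>i\<in>#fst Y. c i \<noteq> a" "\<forall>i\<in>#snd Y. c i = a" using b by (metis color.exhaust)+
    then show ?thesis using a by (auto simp: consistent_def opposed_def)
  qed
qed

lemma consistent_opposed:
  assumes "i \<in># fst X \<and> j \<in># fst Y \<or> i \<in># snd X \<and> j \<in># snd Y"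
  shows "consistent c X \<and> consistent c Y \<and> c i \<noteq> c j \<longleftrightarrow> consistent c (opposed X Y)"
proof
  assume "consistent c X \<and> consistent c Y \<and> c i \<noteq> c j"
  then show "consistent c (opposed X Y)"
    using consistent_aligned[OF assms] consistent_imp_aligned_or_opposed by blast
next
  assume opposed: "consistent c (opposed X Y)"
  then obtain a where a: "\<forall>i\<in>#fst X + snd Y. c i = a" "\<forall>i\<in>#snd X + fst Y. c i \<noteq> a"
    by (auto simp: consistent_def opposed_def)
  then have "consistent c X" "consistent c (snd Y, fst Y)" "c i \<noteq> c j"
    using assms by (auto simp: consistent_def)
  then show "consistent c X \<and> consistent c Y \<and> c i \<noteq> c j"
    by (simp add: consistent_swap)
qed

lemma possible_split_aligned:
  assumes "i \<in># fst X \<and> j \<in># fst Y \<or> i \<in># snd X \<and> j \<in># snd Y"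
  shows "{c \<in> possible N p (add_mset X (add_mset Y C)). c i = c j} =
      possible N p (add_mset (aligned X Y) C)"
    "{c \<in> possible N p (add_mset X (add_mset Y C)). c i \<noteq> c j} =
      possible N p (add_mset (opposed X Y) C)"
  using consistent_aligned[OF assms] consistent_opposed[OF assms] by (auto simp: possible_def)

lemma possible_split_opposed:
  assumes "i \<in># fst X \<and> j \<in># snd Y \<or> i \<in># snd X \<and> j \<in># fst Y"
  shows "{c \<in> possible N p (add_mset X (add_mset Y C)). c i = c j} =
      possible N p (add_mset (opposed X Y) C)"
    "{c \<in> possible N p (add_mset X (add_mset Y C)). c i \<noteq> c j} =
      possible N p (add_mset (aligned X Y) C)"
proof -
  have swap: "possible N p (add_mset X (add_mset (snd Y, fst Y) C)) =
      possible N p (add_mset X (add_mset Y C))"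
    by (simp add: possible_def consistent_swap)
  have "aligned X (snd Y, fst Y) = opposed X Y" "opposed X (snd Y, fst Y) = aligned X Y"
    by (simp_all add: aligned_def opposed_def)
  then show "{c \<in> possible N p (add_mset X (add_mset Y C)). c i = c j} =
      possible N p (add_mset (opposed X Y) C)"
    "{c \<in> possible N p (add_mset X (add_mset Y C)). c i \<noteq> c j} =
      possible N p (add_mset (aligned X Y) C)"
    using possible_split_aligned[of i X j "(snd Y, fst Y)" N p C] assms
    unfolding swap by auto
qed

lemma balls_in_component:
  assumes "partitions N C" "i \<in> balls N"
  obtains X where "X \<in># C" "i \<in># members X"
proof -
  have "i \<in># (\<Sum>X\<in>#C. members X)" using assms by (simp add: partitions_def)
  then show thesis using that by auto
qed

lemma component_in_balls:
  assumes "partitions N C" "X \<in># C" "i \<in># members X"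
  shows "i \<in> balls N"
proof -
  have "i \<in># (\<Sum>X\<in>#C. members X)" using assms(2,3) by auto
  then show ?thesis unfolding assms(1)[unfolded partitions_def] by simp
qed

lemma identifies_Compare:
  assumes "i \<in> balls N" "j \<in> balls N" "i \<noteq> j"
    "identifies N {c \<in> T. c i = c j} s k" "identifies N {c \<in> T. c i \<noteq> c j} d k"
  shows "identifies N T (Compare i j s d) (Suc k)"
  using assms unfolding identifies_def by auto

text \<open>The questioner plays the weight game by comparing balls from the larger classes of the two
  components. The answer ``same'' gives the aligned component, of weight \<open>x + y\<close>; the answer
  ``different'' gives the opposed one, of weight \<open>x - y\<close>, in which \<open>y\<close> more green balls are certain.
  When \<open>y\<close> exceeds the budget, no possible coloring gives the answer ``different'' and that branch of the
  strategy is irrelevant.\<close>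

theorem strategy_if_resolvable:
  assumes "resolvable r M k" "partitions N C" "oriented C" "r + forced C = p"
    "M = image_mset weight C"
  shows "\<exists>t. identifies N (possible N p C) t k"
  using assms
proof (induction arbitrary: C rule: resolvable.induct)
  case (settled M r k)
  let ?v = "minority_coloring C"
  have "c i = ?v i" if c: "c \<in> possible N p C" and i: "i \<in> balls N" for c i
  proof -
    obtain X where X: "X \<in># C" "i \<in># members X" using balls_in_component settled.prems(1) i .
    have v: "?v \<in> possible N p C"
      using minority_coloring_possible[OF settled.prems(1), of p] settled.prems(3) by simp
    have "r < weight X" using settled X by auto
    then have "p < forced C + weight X" using settled.prems(3) by simp
    note det = heavy_component_determined[OF settled.prems(1,2) _ X(1) this]
    show ?thesis using det[OF c] det[OF v] X(2) by (auto simp: members_def)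
  qed
  then have "identifies N (possible N p C) (Announce ?v) k"
    by (simp add: identifies_def)
  then show ?case by blast
next
  case (merge y x r M k)
  obtain X C1 where C1: "C = add_mset X C1" "x = weight X" "add_mset y M = image_mset weight C1"
    using merge.prems(4) by (metis msed_map_invR)
  obtain Y C2 where C2: "C1 = add_mset Y C2" "y = weight Y" "M = image_mset weight C2"
    using C1(3) by (metis msed_map_invR)
  have C: "C = add_mset X (add_mset Y C2)" using C1 C2 by simp
  note state = weight_aligned_opposed[OF merge.prems(2)[unfolded C]
      merge.hyps(1)[unfolded C1(2) C2(2)]]
  have parts: "partitions N (add_mset (aligned X Y) C2)" "partitions N (add_mset (opposed X Y) C2)"
    using merge.prems(1) by (simp_all add: partitions_aligned_opposed C)
  obtain s where s: "identifies N (possible N p (add_mset (aligned X Y) C2)) s k"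
    using merge.IH(1)[OF parts(1) state(3)] merge.prems(3) state(1,5) C C1(2) C2(2,3) by auto
  obtain d where d: "identifies N (possible N p (add_mset (opposed X Y) C2)) d k"
  proof (cases "y \<le> r")
    case True
    then show thesis
      using merge.IH(2)[OF True parts(2) state(4)] merge.prems(3) state(2,6) C C1(2) C2(2,3) that
      by auto
  next
    case False
    have "c \<notin> possible N p (add_mset (opposed X Y) C2)" for c
      using forced_le_greens[OF parts(2) state(4)] False merge.prems(3) state(6) C C2(2)
      by (fastforce simp: possible_def)
    then have "identifies N (possible N p (add_mset (opposed X Y) C2)) (Announce (\<lambda>_. Red)) k"
      unfolding identifies_def by auto
    then show thesis by (rule that)
  qed
  have "fst X \<noteq> {#}" "fst Y \<noteq> {#}" using merge.prems(2) C by (auto simp: oriented_def)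
  then obtain i j where ij: "i \<in># fst X" "j \<in># fst Y" by (meson multiset_nonemptyE)
  then have balls: "i \<in> balls N" "j \<in> balls N"
    using component_in_balls[OF merge.prems(1), of X i] component_in_balls[OF merge.prems(1), of Y j]
    by (simp_all add: C members_def)
  have "count (\<Sum>X\<in>#C. members X) i \<le> 1"
    using merge.prems(1) by (simp add: partitions_def count_mset_set')
  then have "i \<noteq> j" using ij by (auto simp: C members_def dest!: multi_member_split)
  then have "identifies N (possible N p C) (Compare i j s d) (Suc k)"
    using s d balls ij unfolding C
    by (intro identifies_Compare) (simp_all add: possible_split_aligned)
  then show ?case by blast
qed

text \<open>Conversely every strategy plays the weight game: a comparison of balls from different components
  merges them, with one answer leading to the aligned and the other to the opposed component, and a
  comparison within a component is a wasted move.\<close>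

theorem resolvable_if_strategy:
  assumes "identifies N (possible N p C) t k" "partitions N C" "oriented C" "r + forced C = p"
  shows "resolvable r (image_mset weight C) k"
  using assms
proof (induction t arbitrary: C r k)
  case (Announce v)
  have "r < weight X" if X: "X \<in># C" for X
  proof (rule ccontr)
    assume light: "\<not> r < weight X"
    have announced: "c i = v i" if "c \<in> possible N p C" "i \<in> balls N" for c i
      using Announce.prems(1) that by (auto simp: identifies_def)
    obtain C' where C: "C = add_mset X C'" using X by (meson multi_member_split)
    have X': "size (snd X) \<le> size (fst X)" "fst X \<noteq> {#}"
      using Announce.prems(3) X by (auto simp: oriented_def)
    \<comment> \<open>turning \<open>X\<close> over keeps the same possible colorings, and the number of certain green balls
      stays within the budget\<close>
    define C2 where "C2 = add_mset (snd X, fst X) C'"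
    have "partitions N C2" using Announce.prems(2)
      by (simp add: C C2_def partitions_def members_def ac_simps)
    moreover have "forced C2 \<le> p"
      using Announce.prems(4) light X' by (simp add: C C2_def forced_def weight_def)
    ultimately have "minority_coloring C2 \<in> possible N p C"
      using minority_coloring_possible[of N C2 p] by (simp add: C C2_def possible_def consistent_swap)
    moreover have "minority_coloring C \<in> possible N p C"
      using minority_coloring_possible[OF Announce.prems(2), of p] Announce.prems(4) by simp
    moreover obtain i where i: "i \<in># fst X" using X'(2) by (meson multiset_nonemptyE)
    moreover from this have "i \<in> balls N"
      using component_in_balls[OF Announce.prems(2) X] by (simp add: members_def)
    ultimately have "minority_coloring C2 i = minority_coloring C i"
      using announced[of "minority_coloring C2" i] announced[of "minority_coloring C" i] by simp
    moreover have "minority_coloring C2 i = Green"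
      using i by (simp add: C2_def minority_coloring_def)
    moreover have "minority_coloring C i = Red"
      using fst_not_in_minority[OF Announce.prems(2) X i] by (simp add: minority_coloring_def)
    ultimately show False by simp
  qed
  then show ?case by (intro settled) auto
next
  case (Compare i j s d)
  let ?T = "possible N p C"
  have "?T \<noteq> {}"
    using minority_coloring_possible[OF Compare.prems(2), of p] Compare.prems(4) by auto
  then obtain k' where k: "k = Suc k'"
    using Compare.prems(1) by (cases k) (auto simp: identifies_def)
  have s: "identifies N {c \<in> ?T. c i = c j} s k'" and d: "identifies N {c \<in> ?T. c i \<noteq> c j} d k'"
    using Compare.prems(1) unfolding identifies_def k by auto
  have "i \<in> balls N" "j \<in> balls N" using Compare.prems(1) by (auto simp: identifies_def)
  then obtain X Y where XY: "X \<in># C" "i \<in># members X" "Y \<in># C" "j \<in># members Y"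
    using balls_in_component[OF Compare.prems(2)] by metis
  obtain C1 where C1: "C = add_mset X C1" using XY(1) by (meson multi_member_split)
  show ?case
  proof (cases "X = Y")
    case True
    have "{c \<in> ?T. c i = c j} = ?T \<or> {c \<in> ?T. c i \<noteq> c j} = ?T"
      \<comment> \<open>the answer is known in advance, so the branch taken keeps all possible colorings\<close>
    proof (cases "i \<in># fst X \<and> j \<in># fst X \<or> i \<in># snd X \<and> j \<in># snd X")
      case same: True
      have "c i = c j" if "c \<in> ?T" for c
      proof -
        have "consistent c X" using that XY(1) by (simp add: possible_def)
        then show ?thesis using same by (cases rule: consistent_cases) auto
      qed
      then show ?thesis by blast
    next
      case different: False
      have "c i \<noteq> c j" if "c \<in> ?T" for c
      proof -
        have "consistent c X" using that XY(1) by (simp add: possible_def)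
        then show ?thesis
          using different XY(2,4) True by (cases rule: consistent_cases) (auto simp: members_def)
      qed
      then show ?thesis by blast
    qed
    then have "identifies N ?T s k' \<or> identifies N ?T d k'"
      using s d by auto
    then have "resolvable r (image_mset weight C) k'"
      using Compare.IH Compare.prems(2-4) by blast
    then show ?thesis unfolding k by (rule resolvable_Suc)
  next
    case False
    then obtain C2 where C: "C = add_mset X (add_mset Y C2)"
      using C1 XY(3) by (metis insert_noteq_member multi_member_split)
    \<comment> \<open>stated for arbitrary \<open>X\<close>, \<open>Y\<close>, \<open>i\<close>, \<open>j\<close> so that the two components may be exchanged to make
      \<open>Y\<close> the lighter one\<close>
    have *: "resolvable r (image_mset weight C) (Suc k')"
      if C: "C = add_mset X (add_mset Y C2)" and lighter: "weight Y \<le> weight X"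
        and ij: "i \<in># members X" "j \<in># members Y"
        and sd: "identifies N {c \<in> ?T. c i = c j} s k'" "identifies N {c \<in> ?T. c i \<noteq> c j} d k'"
      for X Y i j
    proof -
      note state = weight_aligned_opposed[OF Compare.prems(3)[unfolded C] lighter]
      have parts: "partitions N (add_mset (aligned X Y) C2)"
        "partitions N (add_mset (opposed X Y) C2)"
        using Compare.prems(2) by (simp_all add: partitions_aligned_opposed C)
      have "(i \<in># fst X \<and> j \<in># fst Y \<or> i \<in># snd X \<and> j \<in># snd Y) \<or>
          (i \<in># fst X \<and> j \<in># snd Y \<or> i \<in># snd X \<and> j \<in># fst Y)"
        using ij by (auto simp: members_def)
      then have "\<exists>s'\<in>{s, d}. \<exists>d'\<in>{s, d}.
          identifies N (possible N p (add_mset (aligned X Y) C2)) s' k' \<and>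
          identifies N (possible N p (add_mset (opposed X Y) C2)) d' k'"
      proof
        assume classes: "i \<in># fst X \<and> j \<in># fst Y \<or> i \<in># snd X \<and> j \<in># snd Y"
        show ?thesis
          using sd unfolding C possible_split_aligned[OF classes] by blast
      next
        assume classes: "i \<in># fst X \<and> j \<in># snd Y \<or> i \<in># snd X \<and> j \<in># fst Y"
        show ?thesis
          using sd unfolding C possible_split_opposed[OF classes] by blast
      qed
      then obtain s' d' where "s' \<in> {s, d}" "d' \<in> {s, d}"
        and "identifies N (possible N p (add_mset (aligned X Y) C2)) s' k'"
        and "identifies N (possible N p (add_mset (opposed X Y) C2)) d' k'"
        by blast
      then have al: "resolvable r' (image_mset weight (add_mset (aligned X Y) C2)) k'"
        if "r' + forced (add_mset (aligned X Y) C2) = p" for r'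
        using Compare.IH parts(1) state(3) that by blast
      have op: "resolvable r' (image_mset weight (add_mset (opposed X Y) C2)) k'"
        if "r' + forced (add_mset (opposed X Y) C2) = p" for r'
        using Compare.IH parts(2) state(4) that \<open>d' \<in> {s, d}\<close>
          \<open>identifies N (possible N p (add_mset (opposed X Y) C2)) d' k'\<close> by blast
      have "resolvable r (add_mset (weight X) (add_mset (weight Y) (image_mset weight C2))) (Suc k')"
      proof (rule merge)
        show "resolvable r (add_mset (weight X + weight Y) (image_mset weight C2)) k'"
          using al[of r] state(1,5) Compare.prems(4) C by simp
        show "resolvable (r - weight Y) (add_mset (weight X - weight Y) (image_mset weight C2)) k'"
          if "weight Y \<le> r"
          using op[of "r - weight Y"] state(2,6) Compare.prems(4) C that by simp
      qed (rule lighter)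
      then show ?thesis unfolding C by simp
    qed
    show ?thesis
    proof (cases "weight Y \<le> weight X")
      case True
      then show ?thesis using *[OF C True XY(2,4) s d] k by simp
    next
      case False
      have "C = add_mset Y (add_mset X C2)" using C by (simp add: add_mset_commute)
      moreover have "{c \<in> ?T. c j = c i} = {c \<in> ?T. c i = c j}"
        "{c \<in> ?T. c j \<noteq> c i} = {c \<in> ?T. c i \<noteq> c j}" by auto
      ultimately show ?thesis using *[of Y X j i] XY(2,4) s d k False by simp
    qed
  qed
qed

lemma majored_iff_greens:
  assumes "2 * p < N"
  shows "majored N p c \<longleftrightarrow> greens N c \<le> p"
proof -
  have "balls N = {i \<in> balls N. c i = Green} \<union> {i \<in> balls N. c i = Red}"
    by (auto intro: color.exhaust)
  then have "card (balls N) = greens N c + card {i \<in> balls N. c i = Red}"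
    unfolding greens_def by (subst card_Un_disjoint[symmetric]) auto
  then have "N = greens N c + card {i \<in> balls N. c i = Red}" by (simp add: balls_def)
  then show ?thesis using assms by (auto simp: majored_def red_green_def greens_def)
qed

text \<open>Since \<open>2 * p < N\<close>, at most \<open>p\<close> green balls are automatically a minority, so the count of green
  balls is the only constraint. The game starts with every ball as a component of weight 1.\<close>

theorem solves_iff_resolvable:
  assumes "2 * p < N"
  shows "(\<exists>t. solves N p k t) \<longleftrightarrow> resolvable p (replicate_mset N 1) k"
proof -
  define C where "C = image_mset (\<lambda>i. ({#i#}, {#} :: nat multiset)) (mset_set (balls N))"
  have parts: "partitions N C"
    by (simp add: C_def partitions_def members_def multiset.map_comp comp_def)
  have "oriented C" "p + forced C = p"
    by (auto simp: C_def oriented_def forced_def multiset.map_comp comp_def)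
  moreover have "image_mset weight C = replicate_mset N 1"
    by (simp add: C_def weight_def multiset.map_comp comp_def image_mset_const_eq balls_def)
  moreover have "solves N p k t \<longleftrightarrow> identifies N (possible N p C) t k" for t
    by (auto simp: solves_def identifies_def majored_iff_greens[OF assms] possible_def C_def consistent_def)
  ultimately show ?thesis
    using strategy_if_resolvable[OF _ parts] resolvable_if_strategy[OF _ parts] by metis
qed

section \<open>The questioner\<close>

text \<open>A determined component stays determined whatever is merged into it, as the difference lowers
  its weight and the budget by the same amount. Hence it can swallow all of \<open>U\<close>, one move each.\<close>

lemma resolvable_absorb:
  assumes "r < x" "\<And>z. z \<in># D \<Longrightarrow> r < z"
  shows "resolvable r (add_mset x D + U) (size U)"
  using assms
proof (induction U arbitrary: x r)
  case empty
  then show ?case by (auto intro!: settled)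
next
  case (add u U)
  show ?case
  proof (cases "u \<le> x")
    case True
    have "resolvable r (add_mset x (add_mset u (D + U))) (Suc (size U))"
    proof (rule merge[OF True])
      show "resolvable r (add_mset (x + u) (D + U)) (size U)"
        using add.IH[of r "x + u"] add.prems by simp
      show "resolvable (r - u) (add_mset (x - u) (D + U)) (size U)" if "u \<le> r"
        using add.IH[of "r - u" "x - u"] add.prems that
        by (auto simp: less_imp_diff_less)
    qed
    then show ?thesis by (simp add: add_mset_commute)
  next
    case False
    then have le: "x \<le> u" by simp
    have "resolvable r (add_mset u (add_mset x (D + U))) (Suc (size U))"
    proof (rule merge[OF le])
      show "resolvable r (add_mset (u + x) (D + U)) (size U)"
        using add.IH[of r "u + x"] add.prems by simp
      show "resolvable (r - x) (add_mset (u - x) (D + U)) (size U)" if "x \<le> r"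
        using that add.prems by simp
    qed
    then show ?thesis by (simp add: add_mset_commute)
  qed
qed

text \<open>The questioner feeds single balls into one growing component of weight \<open>d\<close> until it is
  determined, and then starts the next one, aiming at \<open>m\<close> further determined components; what is left
  over is absorbed. For \<open>d > 0\<close>, a sum keeps \<open>d + n\<close> and a difference lowers \<open>d + n\<close> by 2 and \<open>r\<close>
  by 1, so both preserve the inequality relating \<open>m\<close>, \<open>r\<close> and \<open>d + n\<close>; for \<open>d = 0\<close> both
  answers lead to weight 1 at no cost. Closing a component of weight
  \<open>r + 1 \<le> p + 1\<close> preserves it too, with \<open>m\<close> lowered by 1.\<close>

lemma resolvable_accumulate:
  fixes p :: nat
  assumes "r \<le> p" "d \<le> Suc r" "0 < m" "Suc p * m + 2 * r \<le> p + d + n"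
    and "\<And>z. z \<in># D \<Longrightarrow> r < z"
  shows "resolvable r (add_mset d (D + replicate_mset n 1)) (Suc n - m)"
  using assms
proof (induction n arbitrary: r d m D)
  case 0
  have "Suc p + 2 * r \<le> p + d"
    using 0 mult_le_mono2[of 1 m "Suc p"] by simp
  then have d: "r < d" "m = 1"
  proof -
    show "r < d" using \<open>Suc p + 2 * r \<le> p + d\<close> by simp
    have "Suc p * m \<le> p + Suc p" using 0 by simp
    then have "Suc p * m < Suc p * 2" by simp
    then show "m = 1" using 0 by (simp only: mult_less_cancel1) simp
  qed
  then show ?case using 0 resolvable_absorb[of r d D "{#}"] by simp
next
  case (Suc n)
  obtain m' where m: "m = Suc m'" using Suc.prems(3) by (cases m) auto
  show ?case
  proof (cases "r < d")
    case True
    show ?thesis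
    proof (cases m')
      case 0
      then show ?thesis
        using resolvable_absorb[of r d D "replicate_mset (Suc n) 1"] True Suc.prems m
        by (simp add: add_mset_commute)
    next
      case [simp]: (Suc m'')
      have "resolvable r (add_mset 1 (add_mset d D + replicate_mset n 1)) (Suc n - m')"
        using Suc.prems True m by (intro Suc.IH) auto
      then show ?thesis using m by (simp add: add_mset_commute)
    qed
  next
    case False
    have "Suc p * m = m + p * m' + p" using m by simp
    then have "m \<le> Suc n" using Suc.prems False by simp
    then have count: "Suc (Suc n) - m = Suc (Suc n - m)" by simp
    show ?thesis
    proof (cases d)
      case 0
      have IH: "resolvable r (add_mset 1 (D + replicate_mset n 1)) (Suc n - m)"
        using Suc.prems 0 by (intro Suc.IH) auto
      then have "resolvable r (add_mset 1 (add_mset 0 (D + replicate_mset n 1))) (Suc (Suc n - m))"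
        by (intro merge) auto
      then show ?thesis using 0 count by (simp add: add_mset_commute)
    next
      case [simp]: (Suc e)
      have "resolvable r (add_mset (d + 1) (D + replicate_mset n 1)) (Suc n - m)"
        using Suc.prems False by (intro Suc.IH) auto
      moreover have "resolvable (r - 1) (add_mset (d - 1) (D + replicate_mset n 1)) (Suc n - m)"
        using Suc.prems False by (intro Suc.IH) (auto simp: less_imp_diff_less)
      ultimately have
        "resolvable r (add_mset d (add_mset 1 (D + replicate_mset n 1))) (Suc (Suc n - m))"
        by (intro merge) auto
      then show ?thesis using count by simp
    qed
  qed
qed

corollary resolvable_singletons:
  assumes "0 < m" "Suc p * m + p \<le> N"
  shows "resolvable p (replicate_mset N 1) (N - m)"
proof -
  obtain n where N: "N = Suc n" using assms by (cases N) auto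
  show ?thesis
    using resolvable_accumulate[of p p 1 m n "{#}"] assms unfolding N by simp
qed

section \<open>The adversary\<close>

lemma two_add_mset_split:
  assumes "add_mset x (add_mset y M) = A + B"
  obtains (both_left) A' where "A = add_mset x (add_mset y A')" "M = A' + B"
  | (both_right) B' where "B = add_mset x (add_mset y B')" "M = A + B'"
  | (mixed) u v A' B' where "A = add_mset u A'" "B = add_mset v B'" "M = A' + B'"
      "u = x \<and> v = y \<or> u = y \<and> v = x"
proof -
  have "x \<in># A \<or> x \<in># B"
    by (metis assms union_iff union_single_eq_member)
  then show thesis
  proof
    assume "x \<in># A"
    then obtain A1 where A: "A = add_mset x A1" by (meson multi_member_split)
    then have M: "add_mset y M = A1 + B" using assms by simp
    then have "y \<in># A1 \<or> y \<in># B" by (metis union_iff union_single_eq_member)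
    then show thesis
      using A M by (elim disjE) (auto dest!: multi_member_split intro: that(1,3))
  next
    assume "x \<in># B"
    then obtain B1 where B: "B = add_mset x B1" by (meson multi_member_split)
    then have M: "add_mset y M = A + B1" using assms by simp
    then have "y \<in># A \<or> y \<in># B1" by (metis union_iff union_single_eq_member)
    then show thesis
      using B M by (elim disjE) (auto dest!: multi_member_split intro: that(2,3))
  qed
qed

text \<open>The open components can be given two opposite colorings, each affordable.\<close>

definition balanced :: "nat \<Rightarrow> nat multiset \<Rightarrow> bool" where
  "balanced r U \<longleftrightarrow> (\<exists>X Y. U = X + Y \<and> sum_mset X \<le> r \<and> sum_mset Y \<le> r)"

text \<open>The adversary answers within \<open>U\<close> according to the fixed splitting into \<open>X\<close> and \<open>Y\<close>: the sum for
  two weights on the same side, the difference for two weights on opposite sides. Everything that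
  remains of \<open>U\<close> is then undecided, so \<open>U\<close> never contributes a determined component and each of
  its members has to be merged away, into one another or into \<open>D\<close>.\<close>

lemma resolvable_balanced_part:
  assumes "resolvable r M k" "M = D + U" "balanced r U"
  shows "size U \<le> k"
  using assms
proof (induction arbitrary: D U rule: resolvable.induct)
  case (settled M r k)
  obtain X Y where XY: "U = X + Y" "sum_mset X \<le> r" "sum_mset Y \<le> r"
    using settled.prems by (auto simp: balanced_def)
  have "x \<le> r" if "x \<in># U" for x
    using that XY by (auto dest!: multi_member_split)
  moreover have "r < x" if "x \<in># U" for x
    using that settled by auto
  ultimately have "U = {#}" by (meson leD multiset_nonemptyE)
  then show ?case by simp
next
  case (merge y x r M k)
  note same = merge.IH(1) and diff = merge.IH(2)
  obtain X Y where XY: "U = X + Y" "sum_mset X \<le> r" "sum_mset Y \<le> r"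
    using merge.prems by (auto simp: balanced_def)
  from merge.prems(1) show ?case
  proof (cases rule: two_add_mset_split)
    case (both_left D')
    then show ?thesis using same[of "add_mset (x + y) D'" U] merge.prems by simp
  next
    case (mixed u v D' U')
    have "v \<in># X \<or> v \<in># Y" using mixed(2) XY(1) by (metis union_iff union_single_eq_member)
    then have "balanced r U'"
    proof
      assume "v \<in># X"
      then obtain X' where "X = add_mset v X'" by (meson multi_member_split)
      then show ?thesis
        unfolding balanced_def by (intro exI[of _ X'] exI[of _ Y]) (use mixed(2) XY in auto)
    next
      assume "v \<in># Y"
      then obtain Y' where "Y = add_mset v Y'" by (meson multi_member_split)
      then show ?thesis
        unfolding balanced_def by (intro exI[of _ X] exI[of _ Y']) (use mixed(2) XY in auto)
    qed
    then show ?thesis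
      using same[of "add_mset (x + y) D'" U'] mixed by auto
  next
    case (both_right U')
    then have "add_mset x (add_mset y U') = X + Y" using XY by simp
    then show ?thesis
    proof (cases rule: two_add_mset_split)
      case (both_left X')
      then have "balanced r (add_mset (x + y) U')"
        unfolding balanced_def
        by (intro exI[of _ "add_mset (x + y) X'"] exI[of _ Y]) (use XY in auto)
      then show ?thesis using same[of D] both_right by simp
    next
      case Y: (both_right Y')
      then have "balanced r (add_mset (x + y) U')"
        unfolding balanced_def
        by (intro exI[of _ X] exI[of _ "add_mset (x + y) Y'"]) (use XY in auto)
      then show ?thesis using same[of D] both_right by simp
    next
      case (mixed u v X' Y')
      have "y \<le> r" using mixed XY merge.hyps(1) by auto
      moreover have "balanced (r - y) (add_mset (x - y) U')"
        using mixed(4)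
      proof
        assume "u = x \<and> v = y"
        then show ?thesis
          unfolding balanced_def
          by (intro exI[of _ "add_mset (x - y) X'"] exI[of _ Y']) (use XY mixed merge.hyps(1) in auto)
      next
        assume "u = y \<and> v = x"
        then show ?thesis
          unfolding balanced_def
          by (intro exI[of _ X'] exI[of _ "add_mset (x - y) Y'"]) (use XY mixed merge.hyps(1) in auto)
      qed
      ultimately show ?thesis using diff[of D] both_right by simp
    qed
  qed
qed

text \<open>A weight of at most 1 fits into the lighter side as long as the total is at most \<open>2 * r\<close>.\<close>

lemma balanced_add_units:
  assumes "balanced r U" "set_mset Z \<subseteq> {0, 1}" "sum_mset (U + Z) \<le> 2 * r"
  shows "balanced r (U + Z)"
  using assms(2,3)
proof (induction Z)
  case empty
  then show ?case using assms(1) by simp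
next
  case (add z Z)
  then obtain X Y where XY: "U + Z = X + Y" "sum_mset X \<le> r" "sum_mset Y \<le> r"
    by (auto simp: balanced_def)
  have z: "z \<le> 1" using add.prems by auto
  have "sum_mset (U + Z) = sum_mset X + sum_mset Y" using XY by simp
  then have "sum_mset X + sum_mset Y + z \<le> 2 * r" using add.prems by simp
  then have "z + sum_mset X \<le> r \<or> z + sum_mset Y \<le> r" using z by linarith
  then show ?case
  proof
    assume "z + sum_mset X \<le> r"
    then show ?thesis
      unfolding balanced_def by (intro exI[of _ "add_mset z X"] exI[of _ Y]) (use XY in auto)
  next
    assume "z + sum_mset Y \<le> r"
    then show ?thesis
      unfolding balanced_def by (intro exI[of _ X] exI[of _ "add_mset z Y"]) (use XY in auto)
  qed
qed

text \<open>Weights greater than 1 go one to each side, and the remaining units fill up the gaps.\<close>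

lemma balanced_if_two_heavy:
  assumes "set_mset U \<subseteq> {..r}" "sum_mset U \<le> 2 * r" "size (filter_mset ((<) 1) U) \<le> 2"
  shows "balanced r U"
proof -
  define V where "V = filter_mset ((<) 1) U"
  define Z where "Z = filter_mset (\<lambda>x. \<not> 1 < x) U"
  have U: "U = V + Z" unfolding V_def Z_def by (rule multiset_partition)
  have "set_mset V \<subseteq> {..r}" using assms(1) unfolding V_def by auto
  moreover have "size V = 0 \<or> size V = Suc 0 \<or> size V = Suc (Suc 0)"
    using assms(3) unfolding V_def by linarith
  ultimately have "balanced r V"
  proof (elim disjE)
    assume "set_mset V \<subseteq> {..r}" "size V = Suc (Suc 0)"
    moreover from this obtain x W where V: "V = add_mset x W" "size W = Suc 0"
      using size_eq_Suc_imp_eq_union[of V "Suc 0"] by (metis add_left_cancel plus_1_eq_Suc size_add_mset)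
    moreover from this obtain y where "W = {#y#}"
      using size_1_singleton_mset[of W] by auto
    ultimately have "V = {#x#} + {#y#}" "x \<le> r" "y \<le> r" by auto
    then show ?thesis unfolding balanced_def by (intro exI[of _ "{#x#}"] exI[of _ "{#y#}"]) auto
  next
    assume "set_mset V \<subseteq> {..r}" "size V = Suc 0"
    then obtain x where "V = {#x#} + {#}" "x \<le> r"
      using size_1_singleton_mset[of V] by auto
    then show ?thesis unfolding balanced_def by (intro exI[of _ "{#x#}"] exI[of _ "{#}"]) auto
  qed (auto simp: balanced_def)
  moreover have "set_mset Z \<subseteq> {0, 1}" unfolding Z_def by auto
  ultimately show ?thesis using balanced_add_units assms(2) unfolding U by blast
qed

lemma twice_heavy_le_sum: "2 * size (filter_mset ((<) 1) U) \<le> sum_mset (U :: nat multiset)"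
  by (induction U) auto

text \<open>With budget 2 and open weights 0 and 2, the adversary always answers with the sum until the
  total is at most 4 and the rest is balanced. Each determined component has then cost two twos, and
  the last one or two twos yield none.\<close>

lemma resolvable_2_zeros_and_twos:
  assumes "resolvable r M k" "r = 2" "M = D + E" "set_mset E \<subseteq> {0, 2}"
  shows "size E \<le> k + (sum_mset E - 2) div 4"
  using assms
proof (induction arbitrary: D E rule: resolvable.induct)
  case (settled M r k)
  have "E = {#}"
  proof (rule ccontr)
    assume "E \<noteq> {#}"
    then obtain e where "e \<in># E" by (meson multiset_nonemptyE)
    then show False using settled by fastforce
  qed
  then show ?case by simp
next
  case (merge y x r M k)
  note same = merge.IH(1)
  show ?case
  proof (cases "sum_mset E \<le> 4")
    case True
    have "resolvable r (add_mset x (add_mset y M)) (Suc k)"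
      by (rule resolvable.merge) (use merge in auto)
    then show ?thesis
      using resolvable_balanced_part[OF _ merge.prems(2)] balanced_if_two_heavy[of E 2]
        twice_heavy_le_sum[of E] merge.prems True by fastforce
  next
    case large: False
    from merge.prems(2) show ?thesis
    proof (cases rule: two_add_mset_split)
      case (both_left D')
      then show ?thesis using same[of "add_mset (x + y) D'" E] merge.prems by simp
    next
      case (mixed u v D' E')
      have "size E' \<le> k + (sum_mset E' - 2) div 4"
        by (rule same[of "add_mset (x + y) D'"]) (use mixed merge.prems in auto)
      moreover have "(sum_mset E' - 2) div 4 \<le> (sum_mset E - 2) div 4"
        using mixed by (intro div_le_mono) simp
      ultimately show ?thesis using mixed by simp
    next
      case (both_right E')
      show ?thesis
      proof (cases "x = 2 \<and> y = 2")
        case True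
        have "size E' \<le> k + (sum_mset E' - 2) div 4"
          by (rule same[of "add_mset (x + y) D"]) (use both_right merge.prems in auto)
        moreover from large True both_right obtain e where "e \<in># E'" "e \<noteq> 0"
          by auto
        then have "2 \<le> sum_mset E'"
          using merge.prems(3) both_right by (auto dest!: multi_member_split)
        then have "Suc ((sum_mset E' - 2) div 4) = (sum_mset E' + 2) div 4"
          by presburger
        ultimately show ?thesis using True both_right by simp
      next
        case False
        then have "x + y \<in> {0, 2}" using both_right merge.prems by auto
        then have "size (add_mset (x + y) E') \<le> k + (sum_mset (add_mset (x + y) E') - 2) div 4"
          by (intro same[of D]) (use both_right merge.prems in auto)
        then show ?thesis using both_right by (simp add: add.assoc)
      qed
    qed
  qed
qed

text \<open>With budget 3 these are the positions in which the questioner does better than the total weight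
  suggests: for three twos, the sum determines a component and the difference leaves budget 1,
  which determines the third two. So a total of 6 yields a component although it usually yields none.\<close>

definition odd_twos :: "nat multiset \<Rightarrow> bool" where
  "odd_twos U \<longleftrightarrow> set_mset U \<subseteq> {2} \<and> odd (size U)"

text \<open>An upper bound for the number of determined components that the questioner can enforce, with
  budget 3, from open weights \<open>U\<close> between 1 and 3. The value \<open>(sum_mset U - 3) div 4\<close> expresses that
  each component takes weight 4 and that 3 is lost at the end; for \<open>2 * j + 1\<close> twos it would be
  \<open>j - 1\<close> when \<open>j > 0\<close>, whereas \<open>j\<close> components can be enforced.\<close>

definition capacity :: "nat multiset \<Rightarrow> nat" where
  "capacity U = (if odd_twos U then (size U - 1) div 2 else (sum_mset U - 3) div 4)"

lemma sum_mset_twos: "set_mset U \<subseteq> {2::nat} \<Longrightarrow> sum_mset U = 2 * size U"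
  by (induction U) auto

lemma capacity_mono:
  assumes "0 < v"
  shows "capacity V \<le> capacity (add_mset v V)"
proof (cases "odd_twos V")
  case True
  then have "\<not> odd_twos (add_mset v V)" "sum_mset V = 2 * size V" "odd (size V)"
    using sum_mset_twos[of V] by (auto simp: odd_twos_def)
  then obtain j where "size V = 2 * j + 1" by (elim oddE)
  then show ?thesis
    using \<open>\<not> odd_twos (add_mset v V)\<close> \<open>sum_mset V = 2 * size V\<close> True assms
    by (simp add: capacity_def less_eq_div_iff_mult_less_eq)
next
  case False
  show ?thesis
  proof (cases "odd_twos (add_mset v V)")
    case True
    then have "sum_mset V = 2 * size V" using sum_mset_twos[of V] by (auto simp: odd_twos_def)
    then show ?thesis using True False by (simp add: capacity_def)
  next
    case nodd: False
    then show ?thesis using False by (simp add: capacity_def div_le_mono)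
  qed
qed

text \<open>Completing a component takes weight at least 4, and so one unit of capacity. The exception is
  merging 1 and 3 beside an odd number of twos: the total drops by exactly 4 and the remaining twos
  have one more unit of capacity than their total suggests.\<close>

lemma capacity_complete:
  assumes "4 \<le> x + y" "6 < x + y + sum_mset V \<or> odd_twos (add_mset x (add_mset y V))" "x + y = 4 \<Longrightarrow> odd_twos V \<Longrightarrow> x = 2 \<and> y = 2"
  shows "Suc (capacity V) \<le> capacity (add_mset x (add_mset y V))"
proof (cases "odd_twos V")
  case True
  then have V: "sum_mset V = 2 * size V" "odd (size V)"
    using sum_mset_twos[of V] by (auto simp: odd_twos_def)
  then obtain j where j: "size V = 2 * j + 1" by (elim oddE)
  show ?thesis
  proof (cases "x + y = 4")
    case True
    then have "x = 2" "y = 2" using assms(3) \<open>odd_twos V\<close> by auto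
    then show ?thesis using \<open>odd_twos V\<close> j by (simp add: capacity_def odd_twos_def)
  next
    case False
    then have "\<not> odd_twos (add_mset x (add_mset y V))" by (auto simp: odd_twos_def)
    then show ?thesis
      using \<open>odd_twos V\<close> V j False assms(1) by (simp add: capacity_def less_eq_div_iff_mult_less_eq)
  qed
next
  case False
  show ?thesis
  proof (cases "odd_twos (add_mset x (add_mset y V))")
    case True
    then have xy: "x = 2" "y = 2" "odd (size V)" and V: "sum_mset V = 2 * size V"
      using sum_mset_twos[of V] by (auto simp: odd_twos_def)
    with False True show ?thesis by (auto simp: odd_twos_def)
  next
    case nodd: False
    have "Suc ((sum_mset V - 3) div 4) = (sum_mset V - 3 + 4) div 4" by simp
    also have "\<dots> \<le> (x + (y + sum_mset V) - 3) div 4"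
      by (rule div_le_mono) (use assms(1,2) nodd in simp)
    finally show ?thesis using False nodd by (simp add: capacity_def)
  qed
qed

text \<open>Three weights greater than 1 with total at most 6 are three twos, so otherwise at most two
  weights are heavy.\<close>

lemma balanced_3:
  assumes "set_mset U \<subseteq> {1, 2, 3}" "sum_mset U \<le> 6" "\<not> odd_twos U"
  shows "balanced 3 U"
proof (rule balanced_if_two_heavy)
  show "size (filter_mset ((<) 1) U) \<le> 2"
  proof (rule ccontr)
    assume heavy: "\<not> size (filter_mset ((<) 1) U) \<le> 2"
    have key: "size (filter_mset ((<) 1) V) + size V \<le> sum_mset V"
      if "set_mset V \<subseteq> {1, 2, 3}" for V :: "nat multiset"
      using that by (induction V) auto
    have "size (filter_mset ((<) 1) U) + size U \<le> sum_mset U" by (rule key[OF assms(1)])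
    moreover have "size (filter_mset ((<) 1) U) \<le> size U" by (rule size_filter_mset_lesseq)
    ultimately have size: "size U = 3" "sum_mset U = 6" using assms(2) heavy by linarith+
    have "set_mset U \<subseteq> {2}"
    proof
      fix u assume u: "u \<in># U"
      then obtain V where V: "U = add_mset u V" by (meson multi_member_split)
      have "size (filter_mset ((<) 1) V) + size V \<le> sum_mset V"
        using key[of V] assms(1) V by simp
      moreover have "size V = 2" using size V by simp
      moreover from this have "size (filter_mset ((<) 1) V) \<le> 2"
        using size_filter_mset_lesseq[of "(<) 1" V] by linarith
      ultimately have "u \<noteq> 1" "u \<noteq> 3" using size heavy V by auto
      then show "u \<in> {2}" using u assms(1) by auto
    qed
    then show False using size assms(3) by (simp add: odd_twos_def)
  qed
qed (use assms in auto)

text \<open>The adversary answers with the sum, except in two situations in which this would lead to an odd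
  number of twos without any loss of weight: merging the last two ones beside an even number of twos,
  and merging 1 and 3 beside an odd number of twos. There the difference is better, as it leaves
  budget 2 with open weights 0 and 2 only. Otherwise each component determined this way consumes
  weight at least 4, until a total of at most 6 is balanced and nothing more can be gained.\<close>

lemma resolvable_3_bound:
  assumes "resolvable r M k" "r = 3" "M = D + U" "set_mset U \<subseteq> {1, 2, 3}"
  shows "size U \<le> k + capacity U"
  using assms
proof (induction arbitrary: D U rule: resolvable.induct)
  case (settled M r k)
  have "U = {#}"
  proof (rule ccontr)
    assume "U \<noteq> {#}"
    then obtain u where "u \<in># U" by (meson multiset_nonemptyE)
    then show False using settled by fastforce
  qed
  then show ?case by simp
next
  case (merge y x r M k)
  note same = merge.IH(1)
  show ?case
  proof (cases "sum_mset U \<le> 6 \<and> \<not> odd_twos U")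
    case True
    have "resolvable r (add_mset x (add_mset y M)) (Suc k)"
      by (rule resolvable.merge) (use merge in auto)
    then show ?thesis
      using resolvable_balanced_part[OF _ merge.prems(2)] balanced_3[of U]
        merge.prems True by fastforce
  next
    case large: False
    \<comment> \<open>for merges within \<open>D\<close> or between \<open>U\<close> and \<open>D\<close> the adversary answers with the sum, which does
      not raise the capacity\<close>
    from merge.prems(2) show ?thesis
    proof (cases rule: two_add_mset_split)
      case (both_left D')
      then show ?thesis using same[of "add_mset (x + y) D'" U] merge.prems by simp
    next
      case (mixed u v D' U')
      have "size U' \<le> k + capacity U'"
        by (rule same[of "add_mset (x + y) D'"]) (use mixed merge.prems in auto)
      moreover have "capacity U' \<le> capacity U"
        using mixed merge.prems by (auto intro: capacity_mono)
      ultimately show ?thesis using mixed by simp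
    next
      case (both_right U')
      have xy: "x \<in> {1, 2, 3}" "y \<in> {1, 2, 3}" using both_right merge.prems by auto
      show ?thesis
      proof (cases "x + y \<le> 3")
        case light: True
        show ?thesis
        proof (cases "x = 1 \<and> y = 1 \<and> odd_twos (add_mset 2 U')")
          case True
          then have "size (add_mset 0 U') \<le> k + (sum_mset (add_mset 0 U') - 2) div 4"
            using resolvable_2_zeros_and_twos[of 2 "add_mset 0 M" k D "add_mset 0 U'"]
              merge.hyps merge.prems both_right by (auto simp: odd_twos_def)
          moreover have "sum_mset U' = 2 * size U'"
            using True by (auto simp: odd_twos_def intro: sum_mset_twos)
          moreover obtain j where "size U' = 2 * j"
            using True by (auto simp: odd_twos_def)
          moreover have "(4 * j - 2) div 4 \<le> j - 1" "j - 1 \<le> (4 * j - 1) div 4"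
            by (cases j; simp)+
          ultimately show ?thesis
            using True both_right large
            by (simp add: capacity_def odd_twos_def)
        next
          case False
          have "size (add_mset (x + y) U') \<le> k + capacity (add_mset (x + y) U')"
            by (rule same[of D]) (use xy light both_right merge.prems in auto)
          moreover have "capacity (add_mset (x + y) U') \<le> capacity U"
          proof -
            have "\<not> odd_twos U" using light xy unfolding both_right(1) by (auto simp: odd_twos_def)
            moreover have "\<not> odd_twos (add_mset (x + y) U')"
            proof
              assume odd: "odd_twos (add_mset (x + y) U')"
              then have "x + y = 2" by (simp add: odd_twos_def)
              with xy have "x = 1" "y = 1" by auto
              with odd False show False by (simp add: numeral_2_eq_2)
            qed
            ultimately show ?thesis unfolding both_right(1) by (simp add: capacity_def add.assoc)
          qed
          ultimately show ?thesis using both_right by simp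
        qed
      next
        case heavy: False
        show ?thesis
        proof (cases "x + y = 4 \<and> x \<noteq> y \<and> odd_twos U'")
          case True
          then have "x = 3" "y = 1" using xy merge.hyps(1) by auto
          then have "size (add_mset 2 U') \<le> k + (sum_mset (add_mset 2 U') - 2) div 4"
            using resolvable_2_zeros_and_twos[of 2 "add_mset 2 M" k D "add_mset 2 U'"]
              merge.hyps merge.prems both_right True by (auto simp: odd_twos_def)
          moreover have "capacity U = (sum_mset U' + 1) div 4"
            using both_right \<open>x = 3\<close> \<open>y = 1\<close> by (simp add: capacity_def odd_twos_def)
          moreover have "sum_mset U' div 4 \<le> (sum_mset U' + 1) div 4"
            by (rule div_le_mono) simp
          ultimately show ?thesis
            using both_right by simp
        next
          case False
          have "size U' \<le> k + capacity U'"
            by (rule same[of "add_mset (x + y) D"]) (use both_right merge.prems in auto)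
          moreover have "Suc (capacity U') \<le> capacity U"
            unfolding both_right(1)
          proof (rule capacity_complete)
            show "4 \<le> x + y" using heavy by simp
            show "6 < x + y + sum_mset U' \<or> odd_twos (add_mset x (add_mset y U'))"
              using large unfolding both_right(1) by auto
            show "x = 2 \<and> y = 2" if "x + y = 4" "odd_twos U'"
              using False that by auto
          qed
          ultimately show ?thesis using both_right by simp
        qed
      qed
    qed
  qed
qed

section \<open>The number of comparisons for three green balls\<close>

theorem proposition1:
  fixes N :: nat
  assumes "N \<ge> 7"
  shows "Q_le N 3 = N + 1 - (N + 1) div 4"
proof -
  define m where "m = (N + 1) div 4 - 1"
  have "2 \<le> (N + 1) div 4" "4 * ((N + 1) div 4) \<le> N + 1"
    using assms by (simp_all add: less_eq_div_iff_mult_less_eq)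
  then have m: "0 < m" "4 * m + 3 \<le> N" "N + 1 - (N + 1) div 4 = N - m"
    unfolding m_def by auto
  have "N + 1 = N - 3 + 4" using assms by simp
  then have "(N + 1) div 4 = (N - 3) div 4 + 1" by (metis div_add_self2 zero_neq_numeral)
  then have m_div: "(N - 3) div 4 = m" by (simp add: m_def)
  have "Q_le N 3 = (LEAST k. resolvable 3 (replicate_mset N 1) k)"
    using assms by (simp add: Q_le_def solves_iff_resolvable)
  also have "\<dots> = N - m"
  proof (rule Least_equality)
    show "resolvable 3 (replicate_mset N 1) (N - m)"
      using resolvable_singletons[of m 3 N] m by simp
  next
    fix k assume "resolvable 3 (replicate_mset N 1) k"
    then have "N \<le> k + capacity (replicate_mset N 1)"
      using resolvable_3_bound[of 3 "replicate_mset N 1" k "{#}" "replicate_mset N 1"]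
      by (simp split: if_splits)
    moreover have "capacity (replicate_mset N 1) = m"
      using assms m_div by (simp add: capacity_def odd_twos_def sum_mset_replicate_mset)
    ultimately show "N - m \<le> k" by simp
  qed
  finally show ?thesis using m(3) by simp
qed

end
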